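(* Let $\mathcal{C}_\mathcal{S}$ be the set of convex functions $\psi:\Omega\to\mathbb{R}$ having Property $\mathcal{S}$, where Property $\mathcal{S}$ is any one of (S1), (S2), (S3), and let $\mathcal{D}\subset\mathbb{R}^d$ be the corresponding set (all as given in the context). Define $$\mathcal{F}_\mathcal{S}:=\{(\theta_1,\dots,\theta_n,\xi_1,\dots,\xi_n)\mid \theta_i\in\mathbb{R},\ \xi_i\in\mathcal{D},\ i=1,\dots,n,\ \ \theta_i\ge\theta_j+\langle\xi_j,X_i-X_j\rangle,\ 1\le i,j\le n\}$$ and the set of piecewise linear functions $$\mathcal{K}_\mathcal{S}:=\Big\{\phi:\Omega\to\mathbb{R}\ \Big|\ \phi(x)=\max_{1\le j\le n}\{\theta_j+\langle\xi_j,x-X_j\rangle\},\ (\theta_1,\dots,\theta_n,\xi_1,\dots,\xi_n)\in\mathcal{F}_\mathcal{S}\Big\}.$$ Then $$\min_{\psi\in\mathcal{C}_\mathcal{S}}\sum_{i=1}^n(\psi(X_i)-Y_i)^2=\min_{\phi\in\mathcal{K}_\mathcal{S}}\sum_{i=1}^n(\phi(X_i)-Y_i)^2.$$ Moreover, any solution $\hat\phi$ of the problem $\min_{\phi\in\mathcal{K}_\mathcal{S}}\sum_{i=1}^n(\phi(X_i)-Y_i)^2$ is a solution of the problem $\min_{\psi\in\mathcal{C}_\mathcal{S}}\sum_{i=1}^n(\psi(X_i)-Y_i)^2$.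
   Context: Data: $X_1,\dots,X_n\in\mathbb{R}^d$ and $Y_1,\dots,Y_n\in\mathbb{R}$. The domain $\Omega\subset\mathbb{R}^d$ is an (open) $\delta$-neighborhood, $\delta>0$, of the convex hull $\mathrm{conv}(X_1,\dots,X_n)$. For a convex function $\psi:\Omega\to\mathbb{R}$ and $x\in\Omega$, $\partial\psi(x)=\{g\in\mathbb{R}^d\mid \psi(y)\ge\psi(x)+\langle g,y-x\rangle\ \forall y\in\Omega\}$ is the subdifferential. Property $\mathcal{S}$ of a convex function $\psi:\Omega\to\mathbb{R}$ is one of the following, with the corresponding set $\mathcal{D}$: (S1) (monotone constraint) $K_1,K_2$ are given disjoint subsets of $\{1,\dots,d\}$, and $\psi$ is non-decreasing in each coordinate in $K_1$ and non-increasing in each coordinate in $K_2$; $\mathcal{D}=\{x\in\mathbb{R}^d\mid x_{K_1}\ge0,\ x_{K_2}\le0\}$, where $x_K$ denotes the sub-vector of $x$ with indices in $K$. (S2) (box constraint) $L,U\in\mathbb{R}^d$ are given vectors, and for every $x\in\Omega$ every element $g\in\partial\psi(x)$ satisfies $L\le g\le U$ componentwise; $\mathcal{D}=\{x\in\mathbb{R}^d\mid L\le x\le U\}$. (S3) (Lipschitz constraint) $L>0$ is a given constant, $p\in\{1,2,\infty\}$, and $|\psi(x)-\psi(y)|\le L\|x-y\|_p$ for all $x,y\in\Omega$; $\mathcal{D}=\{x\in\mathbb{R}^d\mid\|x\|_q\le L\}$, where $1/p+1/q=1$. *)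

theory Defs
  imports "HOL-Analysis.Analysis"
begin

definition hull_nbhd :: "nat \<Rightarrow> (nat \<Rightarrow> real^'d) \<Rightarrow> real \<Rightarrow> (real^'d) set" where
  "hull_nbhd n X \<delta> = (\<Union>y \<in> convex hull (X ` {1..n}). ball y \<delta>)"

definition subdifferential ::
  "(real^'d) set \<Rightarrow> (real^'d \<Rightarrow> real) \<Rightarrow> real^'d \<Rightarrow> (real^'d) set" where
  "subdifferential \<Omega> \<psi> x = {g. \<forall>y\<in>\<Omega>. \<psi> y \<ge> \<psi> x + g \<bullet> (y - x)}"

text \<open>The exponent is extended so that the conjugacy relation \<open>1 / p + 1 / q = 1\<close> can be
  stated uniformly: in \<^typ>\<open>ennreal\<close> one has \<open>1 / \<infinity> = 0\<close> and \<open>1 / 0 = \<infinity>\<close>, so that \<open>p = 1\<close> forces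
  \<open>q = \<infinity>\<close> and conversely. Only exponents \<open>p \<ge> 1\<close> are meaningful.\<close>

definition lp_norm :: "ennreal \<Rightarrow> real^'d \<Rightarrow> real" where
  "lp_norm p x = (if p = \<infinity> then Max (range (\<lambda>i. \<bar>x $ i\<bar>))
     else (\<Sum>i\<in>UNIV. \<bar>x $ i\<bar> powr enn2real p) powr (1 / enn2real p))"

text \<open>The Lipschitz constructor takes the constant, the exponent \<open>p\<close> and its conjugate \<open>q\<close>.\<close>

datatype ('d::finite) shape =
    Monotone "'d set" "'d set"
  | Box "real^'d" "real^'d"
  | Lipschitz real ennreal ennreal

fun valid_shape :: "'d::finite shape \<Rightarrow> bool" where
  "valid_shape (Monotone K1 K2) \<longleftrightarrow> K1 \<inter> K2 = {}"
| "valid_shape (Box L U) \<longleftrightarrow> True"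
| "valid_shape (Lipschitz L p q) \<longleftrightarrow> L > 0 \<and> p \<in> {1, 2, \<infinity>} \<and> 1 / p + 1 / q = 1"

fun has_shape :: "(real^'d) set \<Rightarrow> 'd::finite shape \<Rightarrow> (real^'d \<Rightarrow> real) \<Rightarrow> bool" where
  "has_shape \<Omega> (Monotone K1 K2) \<psi> \<longleftrightarrow>
     (\<forall>x\<in>\<Omega>. \<forall>y\<in>\<Omega>. \<forall>k. x $ k \<le> y $ k \<and> (\<forall>j. j \<noteq> k \<longrightarrow> x $ j = y $ j) \<longrightarrow>
        (k \<in> K1 \<longrightarrow> \<psi> x \<le> \<psi> y) \<and> (k \<in> K2 \<longrightarrow> \<psi> y \<le> \<psi> x))"
| "has_shape \<Omega> (Box L U) \<psi> \<longleftrightarrow> (\<forall>x\<in>\<Omega>. \<forall>g \<in> subdifferential \<Omega> \<psi> x. L \<le> g \<and> g \<le> U)"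
| "has_shape \<Omega> (Lipschitz L p q) \<psi> \<longleftrightarrow>
     (\<forall>x\<in>\<Omega>. \<forall>y\<in>\<Omega>. \<bar>\<psi> x - \<psi> y\<bar> \<le> L * lp_norm p (x - y))"

fun slope_set :: "'d::finite shape \<Rightarrow> (real^'d) set" where
  "slope_set (Monotone K1 K2) = {x. (\<forall>k\<in>K1. x $ k \<ge> 0) \<and> (\<forall>k\<in>K2. x $ k \<le> 0)}"
| "slope_set (Box L U) = {x. L \<le> x \<and> x \<le> U}"
| "slope_set (Lipschitz L p q) = {x. lp_norm q x \<le> L}"

text \<open>A function \<open>\<Omega> \<rightarrow> \<real>\<close> is represented by a total function whose values outside \<open>\<Omega>\<close> are
  irrelevant; both classes below are closed under changing these values.\<close>

definition shape_class :: "(real^'d) set \<Rightarrow> 'd::finite shape \<Rightarrow> (real^'d \<Rightarrow> real) set" where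
  "shape_class \<Omega> S = {\<psi>. convex_on \<Omega> \<psi> \<and> has_shape \<Omega> S \<psi>}"

definition feasible_params ::
  "nat \<Rightarrow> (nat \<Rightarrow> real^'d) \<Rightarrow> 'd::finite shape \<Rightarrow> ((nat \<Rightarrow> real) \<times> (nat \<Rightarrow> real^'d)) set" where
  "feasible_params n X S = {(\<theta>, \<xi>). (\<forall>i\<in>{1..n}. \<xi> i \<in> slope_set S) \<and>
     (\<forall>i\<in>{1..n}. \<forall>j\<in>{1..n}. \<theta> i \<ge> \<theta> j + \<xi> j \<bullet> (X i - X j))}"

definition piecewise_linear_class ::
  "(real^'d) set \<Rightarrow> nat \<Rightarrow> (nat \<Rightarrow> real^'d) \<Rightarrow> 'd::finite shape \<Rightarrow> (real^'d \<Rightarrow> real) set" where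
  "piecewise_linear_class \<Omega> n X S =
     {\<phi>. \<exists>(\<theta>, \<xi>) \<in> feasible_params n X S.
        \<forall>x\<in>\<Omega>. \<phi> x = (MAX j\<in>{1..n}. \<theta> j + \<xi> j \<bullet> (x - X j))}"

definition squared_loss ::
  "nat \<Rightarrow> (nat \<Rightarrow> real^'d) \<Rightarrow> (nat \<Rightarrow> real) \<Rightarrow> (real^'d \<Rightarrow> real) \<Rightarrow> real" where
  "squared_loss n X Y \<psi> = (\<Sum>i=1..n. (\<psi> (X i) - Y i)\<^sup>2)"

end

theory Submission
  imports Defs
begin

text \<open>A maximum of affine functions with slopes in \<open>\<D>\<close> is convex and has the required shape, so
  \<open>\<K> \<subseteq> \<C>\<close>. Conversely, every \<open>\<psi> \<in> \<C>\<close> has subgradients at the data points, the shape forces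
  them into \<open>\<D>\<close>, and the maximum of the supporting affine functions lies in \<open>\<K>\<close> and agrees with
  \<open>\<psi>\<close> at the data points. As the loss only sees these values, both problems have the same infimum.
  It is attained because the set of feasible \<open>\<theta>\<close> is closed, which needs an argument only for
  monotone constraints, where the slopes are not bounded.\<close>

subsection \<open>Conjugate exponents\<close>

lemma one_divide_ennreal: "r > 0 \<Longrightarrow> 1 / ennreal r = ennreal (1 / r)"
  using divide_ennreal[of 1 r] by simp

text \<open>Reduces every statement about conjugate exponents to three explicit pairs, for which the
  norms have elementary formulas.\<close>

lemma conjugate_exponent_cases:
  fixes p q :: ennreal
  assumes "p \<in> {1, 2, \<infinity>}" "1 / p + 1 / q = 1"
  shows "(p = 1 \<and> q = \<infinity>) \<or> (p = 2 \<and> q = 2) \<or> (p = \<infinity> \<and> q = 1)"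
proof -
  have half: "1 / (2::ennreal) = ennreal (1 / 2)"
    using one_divide_ennreal[of 2] by simp
  consider "p = 1" | "p = 2" | "p = \<infinity>" using assms(1) by auto
  then show ?thesis
  proof cases
    case 1
    then have "1 / q = 0"
      using assms(2) ennreal_add_left_cancel[of 1 "1 / q" 0] by simp
    then show ?thesis using 1 by (simp add: ennreal_divide_eq_0_iff)
  next
    case 2
    show ?thesis
    proof (cases q)
      case (real r)
      \<comment> \<open>Since 1 / 0 = \<infinity> in \<open>ennreal\<close>, r = 0 would make the
        sum infinite.\<close>
      have "r > 0" using assms(2) 2 real by (cases "r = 0") auto
      then have "1 / p + 1 / q = ennreal (1 / 2 + 1 / r)"
        unfolding 2 real half by (simp add: one_divide_ennreal ennreal_plus del: ennreal_half)
      then have "1 / 2 + 1 / r = 1" by (metis assms(2) ennreal_eq_1)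
      then have "r = 2" using \<open>r > 0\<close> by (simp add: field_simps)
      then show ?thesis using 2 real by simp
    next
      case top
      then have "ennreal (1 / 2) = 1" using assms(2) half 2 by simp
      then have "1 / 2 = (1::real)" by (simp only: ennreal_eq_1)
      then show ?thesis by simp
    qed
  next
    case 3
    then have q: "1 / q = 1" using assms(2) by simp
    show ?thesis
    proof (cases q)
      case (real r)
      have "r > 0" using q real by (cases "r = 0") auto
      then have "1 / r = 1" using q real by (metis one_divide_ennreal ennreal_eq_1)
      then show ?thesis using 3 real by simp
    next
      case top
      then show ?thesis using q by simp
    qed
  qed
qed

section \<open>Duality of the norms with exponents 1, 2 and \<infinity>\<close>

lemma lp_norm_1: "lp_norm 1 x = (\<Sum>i\<in>UNIV. \<bar>x $ i\<bar>)"
  by (simp add: lp_norm_def sum_nonneg)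

lemma lp_norm_2: "lp_norm 2 x = norm x"
  by (simp add: lp_norm_def norm_vec_def L2_set_def powr_half_sqrt sum_nonneg enn2real_numeral)

lemma lp_norm_top: "lp_norm top x = Max (range (\<lambda>i. \<bar>x $ i\<bar>))"
  by (simp add: lp_norm_def)

lemma inner_le_sum_Max:
  fixes x y :: "real^'d::finite"
  shows "x \<bullet> y \<le> (\<Sum>i\<in>UNIV. \<bar>x $ i\<bar>) * Max (range (\<lambda>i. \<bar>y $ i\<bar>))"
proof -
  have "x $ i * y $ i \<le> \<bar>x $ i\<bar> * Max (range (\<lambda>i. \<bar>y $ i\<bar>))" for i
  proof -
    have "x $ i * y $ i \<le> \<bar>x $ i\<bar> * \<bar>y $ i\<bar>" by (metis abs_ge_self abs_mult)
    also have "\<dots> \<le> \<bar>x $ i\<bar> * Max (range (\<lambda>i. \<bar>y $ i\<bar>))"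
      by (intro mult_left_mono Max_ge) auto
    finally show ?thesis .
  qed
  then show ?thesis
    by (simp add: inner_vec_def sum_distrib_right sum_mono)
qed

text \<open>The pair 2, 2 is Cauchy-Schwarz; the pairs 1, \<infinity> and \<infinity>, 1 are the two
  orders of the coordinatewise estimate. It turns a dual norm bound on slopes into a Lipschitz
  bound.\<close>

lemma lp_norm_Hoelder:
  fixes x y :: "real^'d::finite"
  assumes "p \<in> {1, 2, \<infinity>}" "1 / p + 1 / q = 1"
  shows "x \<bullet> y \<le> lp_norm q x * lp_norm p y"
  using conjugate_exponent_cases[OF assms] inner_le_sum_Max[of x y] inner_le_sum_Max[of y x]
    norm_cauchy_schwarz[of x y]
  by (auto simp: lp_norm_1 lp_norm_2 lp_norm_top inner_commute mult.commute)

lemma lp_norm_nonneg: "lp_norm p x \<ge> 0"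
proof (cases "p = \<infinity>")
  case True
  have "\<bar>x $ undefined\<bar> \<le> Max (range (\<lambda>i. \<bar>x $ i\<bar>))" by (intro Max_ge) auto
  then have "0 \<le> Max (range (\<lambda>i. \<bar>x $ i\<bar>))" by linarith
  then show ?thesis using True by (simp add: lp_norm_top)
qed (simp add: lp_norm_def)

text \<open>The equality case of Hoelder's inequality: a signed unit vector at a largest coordinate
  for p = 1, the normalized vector for p = 2, the vector of signs for p = \<infinity>.\<close>

lemma lp_norm_dual_direction:
  fixes x :: "real^'d::finite"
  assumes "p \<in> {1, 2, \<infinity>}" "1 / p + 1 / q = 1"
  obtains v where "x \<bullet> v = lp_norm q x" "\<And>t. t > 0 \<Longrightarrow> lp_norm p (t *\<^sub>R v) = t"
proof -
  \<comment> \<open>The sign of 0 is taken to be 1, so that \<open>s k\<close> has absolute value 1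
    also at vanishing coordinates.\<close>
  define s where "s k = (if x $ k \<ge> 0 then 1 else - 1 :: real)" for k
  have s: "x $ k * s k = \<bar>x $ k\<bar>" "\<bar>s k\<bar> = 1" for k by (auto simp: s_def)
  consider "p = 1" "q = \<infinity>" | "p = 2" "q = 2" | "p = \<infinity>" "q = 1"
    using conjugate_exponent_cases[OF assms] by blast
  then show thesis
  proof cases
    case 1
    have "Max (range (\<lambda>i. \<bar>x $ i\<bar>)) \<in> range (\<lambda>i. \<bar>x $ i\<bar>)" by (intro Max_in) auto
    then obtain k where k: "\<bar>x $ k\<bar> = lp_norm q x" by (metis 1(2) imageE infinity_ennreal_def lp_norm_top)
    have "lp_norm p (t *\<^sub>R axis k (s k)) = t" if "t > 0" for t
    proof -
      have "(\<Sum>i\<in>UNIV. \<bar>(t *\<^sub>R axis k (s k)) $ i\<bar>) = (\<Sum>i\<in>UNIV. if i = k then t else 0)"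
        using that by (intro sum.cong) (auto simp: axis_def abs_mult s)
      then show ?thesis by (simp add: 1 lp_norm_1)
    qed
    then show thesis using that[of "axis k (s k)"] k by (simp add: inner_axis s)
  next
    case 2
    show thesis
    proof (cases "x = 0")
      case True
      \<comment> \<open>For x = 0 any unit vector will do; \<open>undefined\<close> is just some
        index.\<close>
      then show thesis using that[of "axis undefined 1"] by (simp add: 2 lp_norm_2 norm_axis_1)
    next
      case False
      then show thesis using that[of "x /\<^sub>R norm x"]
        by (simp add: 2 lp_norm_2 power2_norm_eq_inner[symmetric] power2_eq_square)
    qed
  next
    case 3
    have "lp_norm p (t *\<^sub>R (\<chi> i. s i)) = t" if "t > 0" for t
      using that by (simp add: 3 lp_norm_top abs_mult s)
    then show thesis using that[of "\<chi> i. s i"] by (simp add: 3 lp_norm_1 inner_vec_def s)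
  qed
qed

text \<open>A crude comparison through the sum of absolute coordinates, enough to show that balls of
  the dual norm are bounded.\<close>

lemma norm_le_lp_norm:
  fixes x :: "real^'d::finite"
  assumes "p \<in> {1, 2, \<infinity>}" "1 / p + 1 / q = 1"
  shows "norm x \<le> CARD('d) * lp_norm q x"
proof -
  have "norm x \<le> (\<Sum>i\<in>UNIV. \<bar>x $ i\<bar>)" by (rule norm_le_l1_cart)
  also have "\<dots> \<le> (\<Sum>i\<in>(UNIV::'d set). lp_norm q x)"
  proof (rule sum_mono)
    fix i
    show "\<bar>x $ i\<bar> \<le> lp_norm q x"
      using conjugate_exponent_cases[OF assms] member_le_sum[of i UNIV "\<lambda>i. \<bar>x $ i\<bar>"]
      by (auto simp: lp_norm_1 lp_norm_2 lp_norm_top component_le_norm_cart)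
  qed
  finally show ?thesis by simp
qed

lemma closed_lp_norm_le:
  assumes "p \<in> {1, 2, \<infinity>}" "1 / p + 1 / q = 1"
  shows "closed {x :: real^'d::finite. lp_norm q x \<le> L}"
proof -
  consider "q = \<infinity>" | "q = 2" | "q = 1"
    using conjugate_exponent_cases[OF assms] by blast
  then show ?thesis
  proof cases
    case 1
    have "{x :: real^'d. lp_norm q x \<le> L} = (\<Inter>i. {x. \<bar>x $ i\<bar> \<le> L})"
      by (auto simp: 1 lp_norm_top)
    then show ?thesis by (auto intro!: closed_INT closed_Collect_le continuous_intros)
  qed (auto simp: lp_norm_1 lp_norm_2 intro!: closed_Collect_le continuous_intros)
qed

subsection \<open>Subgradients\<close>

text \<open>The neighborhood is the Minkowski sum of two convex sets, the hull and a ball around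
  0.\<close>

lemma convex_hull_nbhd: "convex (hull_nbhd n X \<delta>)"
proof -
  have "hull_nbhd n X \<delta> = (\<Union>x \<in> convex hull (X ` {1..n}). \<Union>y \<in> ball 0 \<delta>. {x + y})"
    by (force simp: hull_nbhd_def dist_norm norm_minus_commute intro: add_diff_cancel_left')
  then show ?thesis by (simp add: convex_sums)
qed

lemma open_hull_nbhd: "open (hull_nbhd n X \<delta>)"
  by (auto simp: hull_nbhd_def)

lemma mem_hull_nbhd: "i \<in> {1..n} \<Longrightarrow> \<delta> > 0 \<Longrightarrow> X i \<in> hull_nbhd n X \<delta>"
  unfolding hull_nbhd_def by (intro UN_I[of "X i"] hull_inc) auto

text \<open>Lets a subgradient be tested in any direction v without leaving the domain.\<close>

lemma open_step:
  fixes x v :: "'a::real_normed_vector"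
  assumes "open S" "x \<in> S"
  obtains t :: real where "t > 0" "x + t *\<^sub>R v \<in> S"
proof -
  have "((\<lambda>t. x + t *\<^sub>R v) \<longlongrightarrow> x + 0 *\<^sub>R v) (at_right 0)" by (intro tendsto_intros)
  then have "\<forall>\<^sub>F t in at_right 0. x + t *\<^sub>R v \<in> S"
    using assms by (auto dest: topological_tendstoD)
  then have "\<forall>\<^sub>F t in at_right 0. t > 0 \<and> x + t *\<^sub>R v \<in> S"
    using eventually_at_right_less by eventually_elim auto
  then show thesis using that
    by (metis (no_types, lifting) eventually_happens trivial_limit_at_right_real)
qed

text \<open>A hyperplane separates the epigraph from the open vertical ray below its point over x.
  As \<Omega> is open, the hyperplane is not vertical, and its slope is a subgradient.\<close>

lemma subdifferential_nonempty:
  fixes \<psi> :: "real^'d::finite \<Rightarrow> real"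
  assumes op: "open \<Omega>" and conv: "convex_on \<Omega> \<psi>" and x: "x \<in> \<Omega>"
  shows "subdifferential \<Omega> \<psi> x \<noteq> {}"
proof -
  let ?T = "{x} \<times> {..<\<psi> x}"
  have "?T \<noteq> {}" by simp
  moreover have "epigraph \<Omega> \<psi> \<noteq> {}" using x by (auto simp: epigraph_def)
  moreover have "?T \<inter> epigraph \<Omega> \<psi> = {}" by (auto simp: epigraph_def)
  moreover have "convex ?T" by (intro convex_Times) auto
  ultimately obtain a b where ab: "a \<noteq> 0" "\<And>z. z \<in> ?T \<Longrightarrow> a \<bullet> z \<le> b"
      "\<And>z. z \<in> epigraph \<Omega> \<psi> \<Longrightarrow> a \<bullet> z \<ge> b"
    using separating_hyperplane_sets[OF _ convex_epigraphI[OF conv], of ?T] by blast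
  obtain g c where a: "a = (g, c)" by (cases a)
  have below: "g \<bullet> x + c * t \<le> b" if "t < \<psi> x" for t
    using ab(2)[of "(x, t)"] that by (simp add: a)
  have above: "g \<bullet> y + c * s \<ge> b" if "y \<in> \<Omega>" "\<psi> y \<le> s" for y s
    using ab(3)[of "(y, s)"] that by (simp add: a epigraph_def)
  \<comment> \<open>The ray omits its endpoint, so the bound at \<open>\<psi> x\<close> is obtained
    as a limit from below.\<close>
  have le: "g \<bullet> x + c * \<psi> x \<le> b"
  proof (rule tendsto_upperbound)
    show "((\<lambda>t. g \<bullet> x + c * t) \<longlongrightarrow> g \<bullet> x + c * \<psi> x) (at_left (\<psi> x))"
      by (intro tendsto_intros)
    show "\<forall>\<^sub>F t in at_left (\<psi> x). g \<bullet> x + c * t \<le> b"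
      using below by (auto simp: eventually_at_filter)
  qed simp
  have "c \<ge> 0" using below[of "\<psi> x - 1"] above[OF x, of "\<psi> x"] by (simp add: algebra_simps)
  \<comment> \<open>For a vertical hyperplane, g would be minimized over \<Omega> at x; a small step
    along -g then forces g = 0, contradicting \<open>a \<noteq> 0\<close>.\<close>
  have "c \<noteq> 0"
  proof
    assume "c = 0"
    obtain t :: real where t: "t > 0" "x + t *\<^sub>R (- g) \<in> \<Omega>" using open_step[OF op x] .
    have "g \<bullet> x \<le> g \<bullet> (x + t *\<^sub>R (- g))" using le above[OF t(2) order_refl] by (simp add: \<open>c = 0\<close>)
    then have "t * (g \<bullet> g) \<le> 0" by (simp add: inner_diff_right)
    then have "g \<bullet> g \<le> 0" using t(1) by (simp add: mult_le_0_iff)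
    then have "g = 0" using inner_gt_zero_iff[of g] by linarith
    then show False using ab(1) a \<open>c = 0\<close> by (simp add: zero_prod_def)
  qed
  then have "c > 0" using \<open>c \<ge> 0\<close> by simp
  have "\<psi> y \<ge> \<psi> x + (- (g /\<^sub>R c)) \<bullet> (y - x)" if "y \<in> \<Omega>" for y
  proof -
    have "g \<bullet> x + c * \<psi> x \<le> g \<bullet> y + c * \<psi> y" using le above[OF that order_refl] by simp
    then show ?thesis using \<open>c > 0\<close> by (simp add: field_simps inner_diff_right)
  qed
  then have "- (g /\<^sub>R c) \<in> subdifferential \<Omega> \<psi> x" unfolding subdifferential_def by blast
  then show ?thesis by blast
qed

text \<open>A short step in \<Omega> bounds the subgradient in the step direction: coordinate
  directions settle the monotone case, a direction attaining the dual norm the Lipschitz case. The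
  box case is the property itself.\<close>

lemma subgradient_in_slope_set:
  fixes \<psi> :: "real^'d::finite \<Rightarrow> real"
  assumes op: "open \<Omega>" and x: "x \<in> \<Omega>" and shape: "has_shape \<Omega> S \<psi>" and valid: "valid_shape S"
    and g: "g \<in> subdifferential \<Omega> \<psi> x"
  shows "g \<in> slope_set S"
proof -
  have sub: "t * (g \<bullet> v) \<le> \<psi> (x + t *\<^sub>R v) - \<psi> x" if "x + t *\<^sub>R v \<in> \<Omega>" for t v
    using g that by (force simp: subdifferential_def)
  show ?thesis
  proof (cases S)
    case (Monotone K1 K2)
    have "g $ k \<ge> 0" if "k \<in> K1" for k
    proof -
      \<comment> \<open>A subgradient bounds increments from below, so a nonnegative component is
        detected by moving down the axis, where \<open>\<psi>\<close> does not increase.\<close>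
      obtain t where t: "t > 0" "x + t *\<^sub>R axis k (-1) \<in> \<Omega>" using open_step[OF op x] .
      have "\<psi> (x + t *\<^sub>R axis k (-1)) \<le> \<psi> x"
        using shape t x that by (auto simp: Monotone axis_def)
      then have "t * (g \<bullet> axis k (-1)) \<le> 0" using sub[OF t(2)] by simp
      then show ?thesis using t(1) by (simp add: inner_axis mult_le_0_iff zero_le_mult_iff)
    qed
    moreover have "g $ k \<le> 0" if "k \<in> K2" for k
    proof -
      obtain t where t: "t > 0" "x + t *\<^sub>R axis k 1 \<in> \<Omega>" using open_step[OF op x] .
      have "\<psi> (x + t *\<^sub>R axis k 1) \<le> \<psi> x"
        using shape t x that by (auto simp: Monotone axis_def)
      then have "t * (g \<bullet> axis k 1) \<le> 0" using sub[OF t(2)] by simp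
      then show ?thesis using t(1) by (simp add: inner_axis mult_le_0_iff)
    qed
    ultimately show ?thesis by (simp add: Monotone)
  next
    case (Box L U)
    then show ?thesis using shape x g by auto
  next
    case (Lipschitz L p q)
    then have pq: "p \<in> {1, 2, \<infinity>}" "1 / p + 1 / q = 1" using valid by auto
    obtain v where v: "g \<bullet> v = lp_norm q g" "\<And>t. t > 0 \<Longrightarrow> lp_norm p (t *\<^sub>R v) = t"
      using lp_norm_dual_direction[OF pq, of g] by blast
    obtain t where t: "t > 0" "x + t *\<^sub>R v \<in> \<Omega>" using open_step[OF op x] .
    have "\<bar>\<psi> (x + t *\<^sub>R v) - \<psi> x\<bar> \<le> L * lp_norm p (x + t *\<^sub>R v - x)"
      using shape t x unfolding Lipschitz has_shape.simps by blast
    then have "\<psi> (x + t *\<^sub>R v) - \<psi> x \<le> t * L" using v(2)[OF t(1)] by (simp add: mult.commute)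
    then have "t * lp_norm q g \<le> t * L" using sub[OF t(2), unfolded v(1)] by linarith
    then show ?thesis using t(1) by (simp add: Lipschitz)
  qed
qed

subsection \<open>Piecewise linear functions\<close>

text \<open>From x to y each affine piece grows by at most c, hence so does the maximum.\<close>

lemma Max_affine_increment:
  fixes X \<xi> :: "'i \<Rightarrow> 'a::real_inner"
  assumes "finite I" "I \<noteq> {}" "\<And>j. j \<in> I \<Longrightarrow> \<xi> j \<bullet> (y - x) \<le> c"
  shows "(MAX j\<in>I. \<theta> j + \<xi> j \<bullet> (y - X j)) \<le> (MAX j\<in>I. \<theta> j + \<xi> j \<bullet> (x - X j)) + c"
proof -
  have "\<theta> j + \<xi> j \<bullet> (y - X j) \<le> (MAX j\<in>I. \<theta> j + \<xi> j \<bullet> (x - X j)) + c" if "j \<in> I" for j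
  proof -
    have "\<theta> j + \<xi> j \<bullet> (x - X j) \<le> (MAX j\<in>I. \<theta> j + \<xi> j \<bullet> (x - X j))"
      using assms(1) that by (intro Max_ge) auto
    then show ?thesis using assms(3)[OF that] by (simp add: inner_diff_right)
  qed
  then show ?thesis using assms(1,2) by (subst Max_le_iff) auto
qed

lemma convex_on_Max_affine:
  fixes X \<xi> :: "'i \<Rightarrow> 'a::real_inner"
  assumes "finite I" "I \<noteq> {}" "convex \<Omega>"
    and \<phi>: "\<And>x. x \<in> \<Omega> \<Longrightarrow> \<phi> x = (MAX j\<in>I. \<theta> j + \<xi> j \<bullet> (x - X j))"
  shows "convex_on \<Omega> \<phi>"
proof (rule convex_onI)
  fix t :: real and x y
  assume t: "0 < t" "t < 1" and xy: "x \<in> \<Omega>" "y \<in> \<Omega>"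
  let ?z = "(1 - t) *\<^sub>R x + t *\<^sub>R y"
  have z: "?z \<in> \<Omega>" using t xy assms(3) by (simp add: convex_def)
  have ge: "\<theta> j + \<xi> j \<bullet> (u - X j) \<le> \<phi> u" if "j \<in> I" "u \<in> \<Omega>" for j u
    using that assms(1) by (auto simp: \<phi> intro: Max_ge)
  have "\<theta> j + \<xi> j \<bullet> (?z - X j) \<le> (1 - t) * \<phi> x + t * \<phi> y" if "j \<in> I" for j
  proof -
    have "\<theta> j + \<xi> j \<bullet> (?z - X j)
        = (1 - t) * (\<theta> j + \<xi> j \<bullet> (x - X j)) + t * (\<theta> j + \<xi> j \<bullet> (y - X j))"
      by (simp add: inner_diff_right inner_add_right algebra_simps)
    also have "\<dots> \<le> (1 - t) * \<phi> x + t * \<phi> y"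
      using t ge[OF that] xy by (intro add_mono mult_left_mono) auto
    finally show ?thesis .
  qed
  then show "\<phi> ?z \<le> (1 - t) * \<phi> x + t * \<phi> y"
    unfolding \<phi>[OF z] using assms(1,2) by (subst Max_le_iff) auto
qed (fact assms)

lemma piecewise_linear_class_subset_shape_class:
  fixes S :: "'d::finite shape"
  assumes op: "open \<Omega>" and conv: "convex \<Omega>" and n: "n \<ge> 1" and valid: "valid_shape S"
  shows "piecewise_linear_class \<Omega> n X S \<subseteq> shape_class \<Omega> S"
proof
  fix \<phi> assume "\<phi> \<in> piecewise_linear_class \<Omega> n X S"
  then obtain \<theta> \<xi> where f: "(\<theta>, \<xi>) \<in> feasible_params n X S"
    and \<phi>: "\<And>x. x \<in> \<Omega> \<Longrightarrow> \<phi> x = (MAX j\<in>{1..n}. \<theta> j + \<xi> j \<bullet> (x - X j))"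
    by (auto simp: piecewise_linear_class_def)
  have slope: "\<xi> j \<in> slope_set S" if "j \<in> {1..n}" for j
    using f that by (auto simp: feasible_params_def)
  \<comment> \<open>All shapes follow from this one-sided bound: c is 0 for monotone, a multiple of
    a bound component for box, and L times the distance for Lipschitz constraints.\<close>
  have incr: "\<phi> y \<le> \<phi> x + c"
    if "x \<in> \<Omega>" "y \<in> \<Omega>" "\<And>j. j \<in> {1..n} \<Longrightarrow> \<xi> j \<bullet> (y - x) \<le> c" for x y c
    using Max_affine_increment[of "{1..n}" \<xi> y x c \<theta> X] that n by (simp add: \<phi>)
  have "has_shape \<Omega> S \<phi>"
  proof (cases S)
    case (Monotone K1 K2)
    have "(k \<in> K1 \<longrightarrow> \<phi> x \<le> \<phi> y) \<and> (k \<in> K2 \<longrightarrow> \<phi> y \<le> \<phi> x)"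
      if xy: "x \<in> \<Omega>" "y \<in> \<Omega>" and k: "x $ k \<le> y $ k" "\<forall>j. j \<noteq> k \<longrightarrow> x $ j = y $ j" for x y k
    proof -
      have d: "y - x = axis k (y $ k - x $ k)" using k by (auto simp: vec_eq_iff axis_def)
      have i: "\<xi> j \<bullet> (y - x) = \<xi> j $ k * (y $ k - x $ k)" for j
        unfolding d by (simp add: inner_axis)
      have i': "\<xi> j \<bullet> (x - y) = - (\<xi> j $ k * (y $ k - x $ k))" for j
        using i[of j] by (simp add: inner_diff_right)
      have "\<phi> x \<le> \<phi> y + 0" if "k \<in> K1"
        using slope that k by (intro incr xy) (auto simp: Monotone i')
      moreover have "\<phi> y \<le> \<phi> x + 0" if "k \<in> K2"
        using slope that k by (intro incr xy) (auto simp: Monotone i mult_nonpos_nonneg)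
      ultimately show ?thesis by simp
    qed
    then show ?thesis unfolding Monotone has_shape.simps by blast
  next
    case (Box L U)
    have "L $ k \<le> g $ k \<and> g $ k \<le> U $ k"
      if x: "x \<in> \<Omega>" and g: "g \<in> subdifferential \<Omega> \<phi> x" for x g k
    proof
      have sub: "t * (g \<bullet> v) \<le> \<phi> (x + t *\<^sub>R v) - \<phi> x" if "x + t *\<^sub>R v \<in> \<Omega>" for t v
        using g that by (force simp: subdifferential_def)
      \<comment> \<open>At a kink g need not be one of the slopes \<open>\<xi> j\<close>, so its
        components are compared with increments of \<open>\<phi>\<close> along both directions of
        the axis.\<close>
      obtain t where t: "t > 0" "x + t *\<^sub>R axis k 1 \<in> \<Omega>" using open_step[OF op x] .
      have "\<phi> (x + t *\<^sub>R axis k 1) \<le> \<phi> x + t * U $ k"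
        using slope t by (intro incr x t) (auto simp: Box less_eq_vec_def inner_axis)
      then have "t * g $ k \<le> t * U $ k" using sub[OF t(2)] by (simp add: inner_axis)
      then show "g $ k \<le> U $ k" using t(1) by simp
      obtain t where t: "t > 0" "x + t *\<^sub>R axis k (-1) \<in> \<Omega>" using open_step[OF op x] .
      have "\<phi> (x + t *\<^sub>R axis k (-1)) \<le> \<phi> x + t * (- L $ k)"
        using slope t by (intro incr x t) (auto simp: Box less_eq_vec_def inner_axis)
      then have "t * L $ k \<le> t * g $ k" using sub[OF t(2)] by (simp add: inner_axis)
      then show "L $ k \<le> g $ k" using t(1) by simp
    qed
    then show ?thesis by (simp add: Box less_eq_vec_def)
  next
    case (Lipschitz L p q)
    then have pq: "p \<in> {1, 2, \<infinity>}" "1 / p + 1 / q = 1" using valid by auto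
    have *: "\<xi> j \<bullet> v \<le> L * lp_norm p v" if "j \<in> {1..n}" for j v
      using lp_norm_Hoelder[OF pq, of "\<xi> j" v] slope[OF that]
        mult_right_mono[OF _ lp_norm_nonneg[of p v], of "lp_norm q (\<xi> j)" L]
      by (simp add: Lipschitz)
    have sym: "lp_norm p (y - x) = lp_norm p (x - y)" for x y :: "real^'d"
      by (simp add: lp_norm_def abs_minus_commute)
    have "\<phi> x \<le> \<phi> y + L * lp_norm p (x - y)" if "x \<in> \<Omega>" "y \<in> \<Omega>" for x y
      using that * by (intro incr) auto
    then have "\<bar>\<phi> x - \<phi> y\<bar> \<le> L * lp_norm p (x - y)" if "x \<in> \<Omega>" "y \<in> \<Omega>" for x y
      using that sym[of x y] by (smt (verit, best))
    then show ?thesis by (simp add: Lipschitz)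
  qed
  moreover have "convex_on \<Omega> \<phi>"
    using convex_on_Max_affine[of "{1..n}", OF _ _ conv \<phi>] n by auto
  ultimately show "\<phi> \<in> shape_class \<Omega> S" by (simp add: shape_class_def)
qed

text \<open>Feasibility says that no piece exceeds \<open>\<theta> i\<close> at \<open>X i\<close>,
  and the piece with j = i attains this value.\<close>

lemma feasible_params_interpolate:
  assumes "(\<theta>, \<xi>) \<in> feasible_params n X S" "i \<in> {1..n}"
  shows "(MAX j\<in>{1..n}. \<theta> j + \<xi> j \<bullet> (X i - X j)) = \<theta> i"
  using assms by (intro Max_eqI) (auto simp: feasible_params_def intro!: image_eqI[of _ _ i])

text \<open>With values \<open>\<psi> (X j)\<close> and subgradients as slopes, the feasibility
  constraints are the subgradient inequalities between data points.\<close>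

lemma piecewise_linear_interpolant:
  fixes S :: "'d::finite shape"
  assumes op: "open \<Omega>" and X: "\<And>i. i \<in> {1..n} \<Longrightarrow> X i \<in> \<Omega>" and valid: "valid_shape S"
    and \<psi>: "\<psi> \<in> shape_class \<Omega> S"
  obtains \<phi> where "\<phi> \<in> piecewise_linear_class \<Omega> n X S" "\<And>i. i \<in> {1..n} \<Longrightarrow> \<phi> (X i) = \<psi> (X i)"
proof -
  have \<psi>': "convex_on \<Omega> \<psi>" "has_shape \<Omega> S \<psi>" using \<psi> by (auto simp: shape_class_def)
  have "\<exists>g. g \<in> subdifferential \<Omega> \<psi> (X i)" if "i \<in> {1..n}" for i
    using subdifferential_nonempty[OF op \<psi>'(1) X[OF that]] by blast
  then obtain \<xi> where \<xi>: "\<And>i. i \<in> {1..n} \<Longrightarrow> \<xi> i \<in> subdifferential \<Omega> \<psi> (X i)" by metis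
  have "\<xi> i \<in> slope_set S" if "i \<in> {1..n}" for i
    using subgradient_in_slope_set[OF op X \<psi>'(2) valid \<xi>] that by blast
  then have f: "(\<lambda>i. \<psi> (X i), \<xi>) \<in> feasible_params n X S"
    using \<xi> X by (auto simp: feasible_params_def subdifferential_def)
  show thesis
  proof (rule that)
    let ?\<phi> = "\<lambda>x. MAX j\<in>{1..n}. \<psi> (X j) + \<xi> j \<bullet> (x - X j)"
    show "?\<phi> \<in> piecewise_linear_class \<Omega> n X S" using f by (auto simp: piecewise_linear_class_def)
    show "?\<phi> (X i) = \<psi> (X i)" if "i \<in> {1..n}" for i
      using feasible_params_interpolate[OF f that] .
  qed
qed

subsection \<open>Existence of a minimizer\<close>

text \<open>Isolates what attainment requires of \<D>. Closed convex sets can fail it: in the region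
  above a parabola, points (m, m^2) have limit direction (0, 1), and subtracting it leaves the
  region.\<close>

definition recession_stable :: "'a::real_normed_vector set \<Rightarrow> bool" where
  "recession_stable D \<longleftrightarrow>
     (\<forall>x u. (\<forall>m. x m \<in> D) \<and> filterlim (\<lambda>m. norm (x m)) at_top sequentially \<and>
        (\<lambda>m. x m /\<^sub>R norm (x m)) \<longlonglongrightarrow> u \<longrightarrow> (\<forall>\<^sub>F m in sequentially. x m - u \<in> D))"

text \<open>Vacuous, as a bounded set contains no sequence with norms tending to infinity.\<close>

lemma recession_stable_bounded:
  assumes "bounded D"
  shows "recession_stable D"
proof -
  obtain B where B: "\<And>x. x \<in> D \<Longrightarrow> norm x \<le> B" using assms by (auto simp: bounded_iff)
  have False if "\<And>m. x m \<in> D" "filterlim (\<lambda>m. norm (x m)) at_top sequentially" for x :: "nat \<Rightarrow> 'a"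
  proof -
    have "\<forall>\<^sub>F m in sequentially. B < norm (x m)" using that(2) by (simp add: filterlim_at_top_dense)
    then obtain m where "B < norm (x m)" by (auto simp: eventually_sequentially)
    then show False using B[OF that(1)[of m]] by simp
  qed
  then show ?thesis unfolding recession_stable_def by blast
qed

text \<open>Dividing by the norms gives \<open>c \<bullet> u \<le> 0\<close>. If equality holds,
  subtracting u changes nothing; otherwise \<open>c \<bullet> x m\<close> tends to minus infinity
  and leaves enough slack.\<close>

lemma eventually_halfspace_recession:
  fixes x :: "nat \<Rightarrow> 'a::real_inner" and b :: "nat \<Rightarrow> real"
  assumes le: "\<And>m. c \<bullet> x m \<le> b m" and bnd: "\<And>m. \<bar>b m\<bar> \<le> B"
    and lim: "filterlim (\<lambda>m. norm (x m)) at_top sequentially" "(\<lambda>m. x m /\<^sub>R norm (x m)) \<longlonglongrightarrow> u"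
  shows "\<forall>\<^sub>F m in sequentially. c \<bullet> (x m - u) \<le> b m"
proof -
  have B: "b m \<le> B" "- B \<le> b m" for m using bnd[of m] by auto
  have dir: "(\<lambda>m. c \<bullet> (x m /\<^sub>R norm (x m))) \<longlonglongrightarrow> c \<bullet> u" by (intro tendsto_intros lim)
  have pos: "\<forall>\<^sub>F m in sequentially. norm (x m) > 0" using lim(1) unfolding filterlim_at_top_dense by blast
  have "(\<lambda>m. B / norm (x m)) \<longlonglongrightarrow> 0" by (rule tendsto_divide_0[OF tendsto_const filterlim_at_top_imp_at_infinity[OF lim(1)]])
  moreover have "\<forall>\<^sub>F m in sequentially. c \<bullet> (x m /\<^sub>R norm (x m)) \<le> B / norm (x m)"
    using pos
  proof eventually_elim
    case (elim m)
    then show ?case using order_trans[OF le B(1), of m] by (simp add: field_simps)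
  qed
  ultimately have "c \<bullet> u \<le> 0" using dir by (intro tendsto_le[OF _ _ dir]) auto
  show ?thesis
  proof (cases "c \<bullet> u = 0")
    case True
    then show ?thesis using le by (simp add: inner_diff_right)
  next
    case False
    then have "c \<bullet> u < 0" using \<open>c \<bullet> u \<le> 0\<close> by simp
    have "filterlim (\<lambda>m. c \<bullet> (x m /\<^sub>R norm (x m)) * norm (x m)) at_bot sequentially"
      by (rule filterlim_tendsto_neg_mult_at_bot[OF dir \<open>c \<bullet> u < 0\<close> lim(1)])
    \<comment> \<open>The threshold is chosen so that \<open>c \<bullet> (x m - u)\<close> is at
      most -B, hence at most \<open>b m\<close>.\<close>
    then have "\<forall>\<^sub>F m in sequentially. c \<bullet> (x m /\<^sub>R norm (x m)) * norm (x m) \<le> c \<bullet> u - B"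
      by (simp add: filterlim_at_bot)
    then show ?thesis using pos
    proof eventually_elim
      case (elim m)
      then have "c \<bullet> (x m /\<^sub>R norm (x m)) * norm (x m) = c \<bullet> x m" by simp
      then show ?case using elim(1) B(2)[of m] unfolding inner_diff_right by linarith
    qed
  qed
qed

text \<open>Monotone slopes form a finite intersection of half-spaces with bound 0; the other two
  sets are bounded.\<close>

lemma recession_stable_slope_set:
  fixes S :: "'d::finite shape"
  assumes "valid_shape S"
  shows "recession_stable (slope_set S)"
proof (cases S)
  case (Monotone K1 K2)
  show ?thesis unfolding recession_stable_def
  proof (intro allI impI)
    fix x :: "nat \<Rightarrow> real^'d" and u
    assume "(\<forall>m. x m \<in> slope_set S) \<and> filterlim (\<lambda>m. norm (x m)) at_top sequentially \<and>
      (\<lambda>m. x m /\<^sub>R norm (x m)) \<longlonglongrightarrow> u"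
    then have D: "\<And>m. x m \<in> slope_set S"
      and lim: "filterlim (\<lambda>m. norm (x m)) at_top sequentially" "(\<lambda>m. x m /\<^sub>R norm (x m)) \<longlonglongrightarrow> u"
      by auto
    have "\<forall>\<^sub>F m in sequentially. k \<in> K1 \<longrightarrow> (x m - u) $ k \<ge> 0" for k
    proof (cases "k \<in> K1")
      case True
      have "\<forall>\<^sub>F m in sequentially. axis k (-1) \<bullet> (x m - u) \<le> 0"
        using D True
        by (intro eventually_halfspace_recession[where b = "\<lambda>_. 0" and B = 0, OF _ _ lim])
          (auto simp: Monotone inner_axis')
      then show ?thesis by (simp add: inner_axis')
    qed simp
    moreover have "\<forall>\<^sub>F m in sequentially. k \<in> K2 \<longrightarrow> (x m - u) $ k \<le> 0" for k
    proof (cases "k \<in> K2")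
      case True
      have "\<forall>\<^sub>F m in sequentially. axis k 1 \<bullet> (x m - u) \<le> 0"
        using D True
        by (intro eventually_halfspace_recession[where b = "\<lambda>_. 0" and B = 0, OF _ _ lim])
          (auto simp: Monotone inner_axis')
      then show ?thesis by (simp add: inner_axis')
    qed simp
    ultimately have "\<forall>\<^sub>F m in sequentially. \<forall>k. (k \<in> K1 \<longrightarrow> (x m - u) $ k \<ge> 0) \<and>
        (k \<in> K2 \<longrightarrow> (x m - u) $ k \<le> 0)"
      by (intro eventually_all_finite eventually_conj)
    then show "\<forall>\<^sub>F m in sequentially. x m - u \<in> slope_set S"
      by eventually_elim (auto simp: Monotone)
  qed
next
  case (Box L U)
  have "slope_set S = cbox L U"
    by (auto simp: Box mem_box_cart less_eq_vec_def)
  then show ?thesis by (simp add: recession_stable_bounded bounded_cbox)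
next
  case (Lipschitz L p q)
  then have pq: "p \<in> {1, 2, \<infinity>}" "1 / p + 1 / q = 1" using assms by auto
  have "norm x \<le> CARD('d) * L" if "x \<in> slope_set S" for x
    using norm_le_lp_norm[OF pq, of x] that
    by (auto simp: Lipschitz intro: order_trans)
  then have "bounded (slope_set S)" by (auto simp: bounded_iff)
  then show ?thesis by (rule recession_stable_bounded)
qed

lemma closed_slope_set:
  assumes "valid_shape S"
  shows "closed (slope_set S)"
proof (cases S)
  case (Monotone K1 K2)
  have "slope_set S = (\<Inter>k\<in>K1. {x. x $ k \<ge> 0}) \<inter> (\<Inter>k\<in>K2. {x. x $ k \<le> 0})"
    by (auto simp: Monotone)
  then show ?thesis by (auto intro!: closed_Int closed_INT closed_Collect_le continuous_intros)
next
  case (Box L U)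
  have "slope_set S = cbox L U"
    by (auto simp: Box mem_box_cart less_eq_vec_def)
  then show ?thesis by (simp add: closed_cbox)
next
  case (Lipschitz L p q)
  then show ?thesis using assms closed_lp_norm_le[of p q L] by simp
qed

text \<open>Take solutions of minimal norm. Were they unbounded, subtracting a limit \<open>u\<close> of their
  directions would preserve feasibility but eventually shorten them.\<close>

lemma closed_linear_inequalities_rhs:
  fixes D :: "'a::euclidean_space set" and a :: "'i \<Rightarrow> 'a" and b :: "nat \<Rightarrow> 'i \<Rightarrow> real"
  assumes I: "finite I" and D: "closed D" "recession_stable D"
    and solv: "\<And>m. \<exists>x\<in>D. \<forall>i\<in>I. a i \<bullet> x \<le> b m i"
    and lim: "\<And>i. i \<in> I \<Longrightarrow> (\<lambda>m. b m i) \<longlonglongrightarrow> \<beta> i"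
  shows "\<exists>x\<in>D. \<forall>i\<in>I. a i \<bullet> x \<le> \<beta> i"
proof -
  define P where "P m = D \<inter> (\<Inter>i\<in>I. {x. a i \<bullet> x \<le> b m i})" for m
  \<comment> \<open>Selects a solution of least norm for each right-hand side.\<close>
  have "\<exists>x\<in>P m. \<forall>y\<in>P m. dist 0 x \<le> dist 0 y" for m
  proof (rule distance_attains_inf)
    show "closed (P m)"
      unfolding P_def by (intro closed_Int closed_INT ballI D(1) closed_halfspace_le)
    show "P m \<noteq> {}" using solv[of m] by (auto simp: P_def)
  qed blast
  then obtain x where x: "\<And>m. x m \<in> P m" and min: "\<And>m y. y \<in> P m \<Longrightarrow> norm (x m) \<le> norm y"
    by (metis dist_0_norm)
  have "bounded (range x)"
  proof (rule ccontr)
    assume unb: "\<not> bounded (range x)"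
    have "\<exists>m. norm (x m) > real N" for N
      using unb by (force simp: bounded_iff not_le)
    then obtain f where f: "\<And>N. norm (x (f N)) > real N" by metis
    have "x (f N) /\<^sub>R norm (x (f N)) \<in> sphere 0 1" for N
      using f[of N] by (cases "x (f N) = 0") auto
    then obtain u s where u: "u \<in> sphere 0 1" and s: "strict_mono s"
      and "((\<lambda>N. x (f N) /\<^sub>R norm (x (f N))) \<circ> s) \<longlonglongrightarrow> u"
      using compact_sphere[of "0::'a" 1, unfolded compact_def, rule_format,
          of "\<lambda>N. x (f N) /\<^sub>R norm (x (f N))"] by blast
    define y where "y m = x (f (s m))" for m
    have dir: "(\<lambda>m. y m /\<^sub>R norm (y m)) \<longlonglongrightarrow> u"
      using \<open>(_ \<circ> s) \<longlonglongrightarrow> u\<close> by (simp add: y_def o_def)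
    have "norm (y m) \<ge> real m" for m
      using f[of "s m"] seq_suble[OF s, of m] unfolding y_def by linarith
    then have inf: "filterlim (\<lambda>m. norm (y m)) at_top sequentially"
      by (intro filterlim_at_top_mono[OF filterlim_real_sequentially]) auto
    have yP: "y m \<in> P (f (s m))" for m by (simp add: y_def x)
    have "\<forall>\<^sub>F m in sequentially. y m - u \<in> D"
      using D(2) dir inf yP unfolding recession_stable_def P_def by blast
    moreover have "\<forall>\<^sub>F m in sequentially. \<forall>i\<in>I. a i \<bullet> (y m - u) \<le> b (f (s m)) i"
    proof (intro eventually_ball_finite I ballI)
      fix i assume i: "i \<in> I"
      \<comment> \<open>The indices \<open>f (s m)\<close> are not known to be increasing, so a
        bound uniform in all m is taken.\<close>
      have "Bseq (\<lambda>m. b m i)" using lim[OF i] by (rule convergent_imp_Bseq[OF convergentI])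
      then obtain B where "\<And>m. \<bar>b m i\<bar> \<le> B" by (auto simp: Bseq_def)
      then show "\<forall>\<^sub>F m in sequentially. a i \<bullet> (y m - u) \<le> b (f (s m)) i"
        using yP i by (intro eventually_halfspace_recession[OF _ _ inf dir]) (auto simp: P_def)
    qed
    \<comment> \<open>As u is a unit vector, subtracting it changes the squared norm by
      \<open>1 - 2 * (y m \<bullet> u)\<close>, and \<open>y m \<bullet> u\<close> tends to
      infinity.\<close>
    moreover have "\<forall>\<^sub>F m in sequentially. norm (y m - u) < norm (y m)"
    proof -
      have "(\<lambda>m. (y m /\<^sub>R norm (y m)) \<bullet> u) \<longlonglongrightarrow> u \<bullet> u" by (intro tendsto_intros dir)
      then have "filterlim (\<lambda>m. (y m /\<^sub>R norm (y m)) \<bullet> u * norm (y m)) at_top sequentially"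
        using u by (intro filterlim_tendsto_pos_mult_at_top[OF _ _ inf]) (auto simp: norm_eq_1)
      then have "\<forall>\<^sub>F m in sequentially. 1 < (y m /\<^sub>R norm (y m)) \<bullet> u * norm (y m)"
        by (simp add: filterlim_at_top_dense)
      then show ?thesis
      proof eventually_elim
        case (elim m)
        moreover have "(y m /\<^sub>R norm (y m)) \<bullet> u * norm (y m) = y m \<bullet> u" by (cases "y m = 0") auto
        ultimately have "1 < y m \<bullet> u" by linarith
        moreover have "u \<bullet> u = 1" using u by (simp add: norm_eq_1)
        ultimately show ?case
          by (simp add: norm_lt inner_diff_left inner_diff_right inner_commute)
      qed
    qed
    ultimately have "\<forall>\<^sub>F m in sequentially. False"
    proof eventually_elim
      case (elim m)
      then have "y m - u \<in> P (f (s m))" by (auto simp: P_def)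
      then show ?case using min[of "y m - u" "f (s m)"] elim(3) by (simp add: y_def)
    qed
    then show False by simp
  qed
  then obtain z s where s: "strict_mono s" and z: "(x \<circ> s) \<longlonglongrightarrow> z"
    using bounded_imp_convergent_subsequence[of x] by blast
  have "z \<in> D" using closed_sequentially[OF D(1) _ z] x by (auto simp: P_def)
  moreover have "a i \<bullet> z \<le> \<beta> i" if "i \<in> I" for i
  proof (rule tendsto_le[OF _ LIMSEQ_subseq_LIMSEQ[OF lim[OF that] s]])
    show "(\<lambda>m. a i \<bullet> (x \<circ> s) m) \<longlonglongrightarrow> a i \<bullet> z" by (intro tendsto_intros z)
    show "\<forall>\<^sub>F m in sequentially. a i \<bullet> (x \<circ> s) m \<le> ((\<lambda>m. b m i) \<circ> s) m"
      using x that by (auto simp: P_def)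
  qed simp
  ultimately show ?thesis by blast
qed

section \<open>Least squares over the feasible values\<close>

text \<open>For fixed \<open>\<theta>\<close> the constraints decouple: each \<open>\<xi> j\<close>
  solves its own finite system of linear inequalities, whose right-hand sides
  \<open>\<theta> i - \<theta> j\<close> converge along the sequence.\<close>

lemma closed_feasible_values:
  fixes S :: "'d::finite shape" and X :: "nat \<Rightarrow> real^'d"
  assumes "valid_shape S"
  shows "closed (fst ` feasible_params n X S)"
  unfolding closed_sequential_limits
proof (intro allI impI, elim conjE)
  fix \<Theta> :: "nat \<Rightarrow> nat \<Rightarrow> real" and \<theta>
  assume \<Theta>: "\<forall>m. \<Theta> m \<in> fst ` feasible_params n X S" and lim: "\<Theta> \<longlonglongrightarrow> \<theta>"
  have lim_i: "(\<lambda>m. \<Theta> m i) \<longlonglongrightarrow> \<theta> i" for i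
    using continuous_on_tendsto_compose[OF continuous_on_product_coordinates[where i = i] lim]
    by simp
  have "\<exists>\<xi>\<in>slope_set S. \<forall>i\<in>{1..n}. (X i - X j) \<bullet> \<xi> \<le> \<theta> i - \<theta> j" if "j \<in> {1..n}" for j
  proof (rule closed_linear_inequalities_rhs)
    show "\<exists>\<xi>\<in>slope_set S. \<forall>i\<in>{1..n}. (X i - X j) \<bullet> \<xi> \<le> \<Theta> m i - \<Theta> m j" for m
    proof -
      obtain \<xi> where "(\<Theta> m, \<xi>) \<in> feasible_params n X S" using \<Theta> by fastforce
      then show ?thesis using that
        by (intro bexI[of _ "\<xi> j"]) (auto simp: feasible_params_def inner_commute algebra_simps)
    qed
    show "(\<lambda>m. \<Theta> m i - \<Theta> m j) \<longlonglongrightarrow> \<theta> i - \<theta> j" for i by (intro tendsto_intros lim_i)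
  qed (auto intro: closed_slope_set recession_stable_slope_set assms)
  then obtain \<xi> where "\<And>j. j \<in> {1..n} \<Longrightarrow> \<xi> j \<in> slope_set S"
    "\<And>i j. j \<in> {1..n} \<Longrightarrow> i \<in> {1..n} \<Longrightarrow> (X i - X j) \<bullet> \<xi> j \<le> \<theta> i - \<theta> j" by metis
  then have "(\<theta>, \<xi>) \<in> feasible_params n X S"
    by (auto simp: feasible_params_def inner_commute algebra_simps)
  then show "\<theta> \<in> fst ` feasible_params n X S" by force
qed

text \<open>Tychonoff's theorem, for the product topology on functions.\<close>

lemma compact_PiE_UNIV:
  fixes A :: "'i \<Rightarrow> 'a::topological_space set"
  assumes "\<And>i. compact (A i)"
  shows "compact (PiE UNIV A)"
  using assms compactin_PiE[of "\<lambda>i. euclidean" UNIV A]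
  by (simp add: euclidean_product_topology)

text \<open>The loss depends on \<open>\<theta>\<close> alone and is continuous, so it suffices to
  minimize it over a compact part of the closed set of feasible values.\<close>

lemma least_squares_feasible_params:
  fixes S :: "'d::finite shape" and X :: "nat \<Rightarrow> real^'d"
  assumes valid: "valid_shape S" and ne: "slope_set S \<noteq> {}"
  obtains \<theta> \<xi> where "(\<theta>, \<xi>) \<in> feasible_params n X S"
    "\<And>\<theta>' \<xi>'. (\<theta>', \<xi>') \<in> feasible_params n X S \<Longrightarrow>
        (\<Sum>i=1..n. (\<theta> i - Y i)\<^sup>2) \<le> (\<Sum>i=1..n. (\<theta>' i - Y i)\<^sup>2)"
proof -
  define F where "F = fst ` feasible_params n X S"
  define loss where "loss \<theta> = (\<Sum>i=1..n. (\<theta> i - Y i)\<^sup>2)" for \<theta> :: "nat \<Rightarrow> real"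
  obtain g where g: "g \<in> slope_set S" using ne by blast
  \<comment> \<open>The values of a linear function with admissible slope g are feasible; their loss
    fixes the radius of the search region.\<close>
  define \<theta>\<^sub>0 where "\<theta>\<^sub>0 i = g \<bullet> X i" for i
  have "(\<theta>\<^sub>0, \<lambda>_. g) \<in> feasible_params n X S"
    using g by (auto simp: feasible_params_def \<theta>\<^sub>0_def inner_diff_right)
  then have \<theta>0: "\<theta>\<^sub>0 \<in> F" by (force simp: F_def)
  define B where "B = PiE UNIV (\<lambda>i. cball (Y i) (sqrt (loss \<theta>\<^sub>0)))"
  have clamp: "\<exists>\<theta>'\<in>F \<inter> B. loss \<theta>' = loss \<theta>" if "\<theta> \<in> F" "loss \<theta> \<le> loss \<theta>\<^sub>0" for \<theta>
  proof
    \<comment> \<open>Feasibility and loss ignore indices outside 1..n; resetting those values to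
      \<open>Y i\<close> puts the sequence into the compact product B.\<close>
    let ?\<theta> = "\<lambda>i. if i \<in> {1..n} then \<theta> i else Y i"
    show "loss ?\<theta> = loss \<theta>" by (simp add: loss_def)
    obtain \<xi> where "(\<theta>, \<xi>) \<in> feasible_params n X S" using \<open>\<theta> \<in> F\<close> by (auto simp: F_def)
    then have "(?\<theta>, \<xi>) \<in> feasible_params n X S" by (auto simp: feasible_params_def)
    then have "?\<theta> \<in> F" by (force simp: F_def)
    moreover have "\<bar>\<theta> i - Y i\<bar> \<le> sqrt (loss \<theta>\<^sub>0)" if "i \<in> {1..n}" for i
    proof -
      have "(\<theta> i - Y i)\<^sup>2 \<le> loss \<theta>"
        unfolding loss_def using that by (intro member_le_sum[where f = "\<lambda>i. (\<theta> i - Y i)\<^sup>2"]) auto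
      then show ?thesis using \<open>loss \<theta> \<le> loss \<theta>\<^sub>0\<close> by (intro real_le_rsqrt) simp
    qed
    moreover have "loss \<theta>\<^sub>0 \<ge> 0" by (simp add: loss_def sum_nonneg)
    ultimately show "?\<theta> \<in> F \<inter> B" by (auto simp: B_def dist_real_def abs_minus_commute)
  qed
  have "compact B" unfolding B_def by (intro compact_PiE_UNIV) simp
  then have "compact (F \<inter> B)"
    using closed_feasible_values[OF valid] by (simp add: F_def closed_Int_compact)
  moreover have "F \<inter> B \<noteq> {}" using clamp[OF \<theta>0] by blast
  moreover have "continuous_on (F \<inter> B) loss"
    unfolding loss_def
    by (intro continuous_intros continuous_on_subset[OF continuous_on_product_coordinates]) auto
  ultimately obtain \<theta> where \<theta>: "\<theta> \<in> F \<inter> B" "\<And>\<theta>'. \<theta>' \<in> F \<inter> B \<Longrightarrow> loss \<theta> \<le> loss \<theta>'"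
    using continuous_attains_inf[of "F \<inter> B" loss] by blast
  \<comment> \<open>Either \<theta>' is no worse than \<open>\<theta>\<^sub>0\<close> and its
    clamped version competes in B, or the clamped \<open>\<theta>\<^sub>0\<close> already beats
    it.\<close>
  have "loss \<theta> \<le> loss \<theta>'" if "\<theta>' \<in> F" for \<theta>'
    using clamp[OF that] clamp[OF \<theta>0] \<theta>(2) by (metis order_trans linear)
  then have "loss \<theta> \<le> loss \<theta>'" if "(\<theta>', \<xi>') \<in> feasible_params n X S" for \<theta>' \<xi>'
    using that by (force simp: F_def)
  moreover obtain \<xi> where "(\<theta>, \<xi>) \<in> feasible_params n X S" using \<theta>(1) by (auto simp: F_def)
  ultimately show thesis using that[of \<theta> \<xi>] unfolding loss_def by blast
qed

section \<open>From parameters to functions\<close>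

lemma squared_loss_cong:
  assumes "\<And>i. i \<in> {1..n} \<Longrightarrow> \<phi> (X i) = \<psi> (X i)"
  shows "squared_loss n X Y \<phi> = squared_loss n X Y \<psi>"
  using assms by (simp add: squared_loss_def)

text \<open>By interpolation, the loss of a function in the class is the loss of its parameters
  \<open>\<theta>\<close>.\<close>

lemma piecewise_linear_minimizer:
  fixes S :: "'d::finite shape" and X :: "nat \<Rightarrow> real^'d"
  assumes X: "\<And>i. i \<in> {1..n} \<Longrightarrow> X i \<in> \<Omega>" and "valid_shape S" "slope_set S \<noteq> {}"
  shows "\<exists>\<phi>. is_arg_min (squared_loss n X Y) (\<lambda>\<phi>. \<phi> \<in> piecewise_linear_class \<Omega> n X S) \<phi>"
proof -
  obtain \<theta> \<xi> where f: "(\<theta>, \<xi>) \<in> feasible_params n X S"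
    and min: "\<And>\<theta>' \<xi>'. (\<theta>', \<xi>') \<in> feasible_params n X S \<Longrightarrow>
        (\<Sum>i=1..n. (\<theta> i - Y i)\<^sup>2) \<le> (\<Sum>i=1..n. (\<theta>' i - Y i)\<^sup>2)"
    using least_squares_feasible_params[OF assms(2,3)] by blast
  have loss: "squared_loss n X Y \<phi> = (\<Sum>i=1..n. (\<theta>' i - Y i)\<^sup>2)"
    if "(\<theta>', \<xi>') \<in> feasible_params n X S"
      "\<forall>x\<in>\<Omega>. \<phi> x = (MAX j\<in>{1..n}. \<theta>' j + \<xi>' j \<bullet> (x - X j))" for \<phi> \<theta>' \<xi>'
    using that X feasible_params_interpolate[OF that(1)] by (simp add: squared_loss_def)
  let ?\<phi> = "\<lambda>x. MAX j\<in>{1..n}. \<theta> j + \<xi> j \<bullet> (x - X j)"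
  have "?\<phi> \<in> piecewise_linear_class \<Omega> n X S" using f by (auto simp: piecewise_linear_class_def)
  moreover have "squared_loss n X Y ?\<phi> \<le> squared_loss n X Y \<phi>"
    if "\<phi> \<in> piecewise_linear_class \<Omega> n X S" for \<phi>
    using that loss[OF f, of ?\<phi>] loss min by (auto simp: piecewise_linear_class_def)
  ultimately show ?thesis by (auto simp: is_arg_min_linorder)
qed

text \<open>A box whose bounds are not ordered has an empty slope set, and then both classes are
  empty. Infima in \<open>ereal\<close> keep the equality meaningful, both being \<infinity>, and
  attainment is claimed for nonempty slope sets.\<close>

theorem theorem1:
  fixes n :: nat and X :: "nat \<Rightarrow> real^'d::finite" and Y :: "nat \<Rightarrow> real"
    and \<delta> :: real and S :: "'d shape"
  defines "\<Omega> \<equiv> hull_nbhd n X \<delta>"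
  defines "\<C> \<equiv> shape_class \<Omega> S" and "\<K> \<equiv> piecewise_linear_class \<Omega> n X S"
  assumes "n \<ge> 1" and "\<delta> > 0" and "valid_shape S"
  shows "(INF \<psi>\<in>\<C>. ereal (squared_loss n X Y \<psi>)) = (INF \<phi>\<in>\<K>. ereal (squared_loss n X Y \<phi>))
    \<and> (slope_set S \<noteq> {} \<longrightarrow>
         (\<exists>\<psi>. is_arg_min (squared_loss n X Y) (\<lambda>\<psi>. \<psi> \<in> \<C>) \<psi>) \<and>
         (\<exists>\<phi>. is_arg_min (squared_loss n X Y) (\<lambda>\<phi>. \<phi> \<in> \<K>) \<phi>))
    \<and> (\<forall>\<phi>. is_arg_min (squared_loss n X Y) (\<lambda>\<phi>. \<phi> \<in> \<K>) \<phi> \<longrightarrow>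
         is_arg_min (squared_loss n X Y) (\<lambda>\<psi>. \<psi> \<in> \<C>) \<phi>)"
proof -
  have X: "X i \<in> \<Omega>" if "i \<in> {1..n}" for i
    using mem_hull_nbhd[OF that \<open>\<delta> > 0\<close>] by (simp add: \<Omega>_def)
  have op: "open \<Omega>" by (simp add: \<Omega>_def open_hull_nbhd)
  have sub: "\<K> \<subseteq> \<C>"
    unfolding \<C>_def \<K>_def using assms(4,6) op
    by (intro piecewise_linear_class_subset_shape_class) (auto simp: \<Omega>_def convex_hull_nbhd)
  have interp: "\<exists>\<phi>\<in>\<K>. squared_loss n X Y \<phi> = squared_loss n X Y \<psi>" if \<psi>: "\<psi> \<in> \<C>" for \<psi>
  proof -
    obtain \<phi> where "\<phi> \<in> \<K>" "\<And>i. i \<in> {1..n} \<Longrightarrow> \<phi> (X i) = \<psi> (X i)"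
      using piecewise_linear_interpolant[where X = X, OF op X assms(6) \<psi>[unfolded \<C>_def]]
      unfolding \<K>_def by metis
    then show ?thesis using squared_loss_cong by blast
  qed
  have "(INF \<psi>\<in>\<C>. ereal (squared_loss n X Y \<psi>)) = (INF \<phi>\<in>\<K>. ereal (squared_loss n X Y \<phi>))"
  proof (rule antisym)
    show "(INF \<psi>\<in>\<C>. ereal (squared_loss n X Y \<psi>)) \<le> (INF \<phi>\<in>\<K>. ereal (squared_loss n X Y \<phi>))"
      by (rule INF_superset_mono[OF sub]) simp
    show "(INF \<phi>\<in>\<K>. ereal (squared_loss n X Y \<phi>)) \<le> (INF \<psi>\<in>\<C>. ereal (squared_loss n X Y \<psi>))"
      using interp by (intro INF_mono) (metis order_refl)
  qed
  \<comment> \<open>Any competitor in \<C> has the loss of its interpolant in \<K>, which a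
    minimizer over \<K> does not exceed.\<close>
  moreover have arg_min: "is_arg_min (squared_loss n X Y) (\<lambda>\<psi>. \<psi> \<in> \<C>) \<phi>"
    if "is_arg_min (squared_loss n X Y) (\<lambda>\<phi>. \<phi> \<in> \<K>) \<phi>" for \<phi>
    using that sub interp unfolding is_arg_min_linorder by (metis subsetD)
  moreover have "\<exists>\<phi>. is_arg_min (squared_loss n X Y) (\<lambda>\<phi>. \<phi> \<in> \<K>) \<phi>" if "slope_set S \<noteq> {}"
    unfolding \<K>_def by (rule piecewise_linear_minimizer[OF X assms(6) that])
  ultimately show ?thesis by blast
qed

end
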